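(* Let $T>0$ be finite, let $M\ge 1$ be an integer, $0<\nu_M<\dots<\nu_1<\nu_0<1$, and let $\mathbf{D}_t$ be the fractional differential operator of type I, $$\mathbf{D}_t v(t)=\sum_{i=0}^{M} r_i(t)\,\mathbf{D}_t^{\nu_i}v(t).$$ Assume: (1) $v\in\mathcal{C}([0,T])$ and $\mathbf{D}_t^{\nu_i}v\in\mathcal{C}([0,T])$ for $i=0,1,\dots,M$; moreover there exist a positive time $T^*\le T$ and some $\nu^*\in(0,1)$ such that $v\in\mathcal{C}^{\nu^*}_{\nu_0}([0,T^*])$ and $\mathbf{D}_t^{\nu_i}v\in\mathcal{C}^{\nu^*}([0,T^*])$ for $i=0,1,\dots,M$; (2) $r_i\in\mathcal{C}([0,T])$ for $i=0,\dots,M$, and $r_0(t)\ne 0$ for all $t\in[0,T]$. If $\mathbf{D}_tv|_{t=0}\neq 0$, then $$\nu_0=\lim_{t\to 0}\frac{t[v(t)-v(0)]}{\int_0^t[v(\tau)-v(0)]\,d\tau}-1,$$ and, besides, for all $t\in[0,T^*]$, $$v(t)=v(0)+\mathfrak{C}_0t^{\nu_0}+\frac{1}{\Gamma(\nu_0)}\int_0^t(t-\tau)^{\nu_0-1}\big[\mathbf{D}_\tau^{\nu_0}v(\tau)-\mathbf{D}_\tau^{\nu_0}v(0)\big]d\tau,\qquad \mathfrak{C}_0=\frac{\mathbf{D}_tv(0)}{r_0(0)\Gamma(1+\nu_0)}.$$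
   Context: All functions are real-valued and limits $t\to0$ are one-sided ($t>0$). For $\nu\in(0,1)$ the regularized (left) Caputo derivative is $$\mathbf{D}_t^{\nu}v(t)=\frac{1}{\Gamma(1-\nu)}\frac{d}{dt}\int_0^t\frac{v(s)-v(0)}{(t-s)^{\nu}}\,ds,$$ where $\Gamma$ is the Euler Gamma-function. When $\mathbf{D}_t^\nu v$ is said to be continuous on a closed interval $[0,T]$, its value at $t=0$ is the continuous extension (limit as $t\to0$). $\mathcal{C}([0,T])$ is the space of continuous functions, $\mathcal{C}^{\alpha}([0,T])$, $\alpha\in(0,1)$, the usual Hölder space with seminorm $\langle\cdot\rangle^{(\alpha)}_{t,[0,T]}$. For $\nu,\alpha\in(0,1)$, $\mathcal{C}^{\alpha}_{\nu}([0,T])$ is the space of continuous $v$ with $\mathbf{D}_t^\nu v$ continuous on $[0,T]$ and finite norm $$\|v\|_{\mathcal{C}^{\alpha}_{\nu}([0,T])}=\|v\|_{\mathcal{C}([0,T])}+\|\mathbf{D}_t^{\nu}v\|_{\mathcal{C}([0,T])}+\langle\mathbf{D}_t^{\nu}v\rangle^{(\alpha)}_{t,[0,T]}.$$ *)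

theory Defs
  imports "HOL-Analysis.Analysis"
begin

definition caputo_integral :: "real \<Rightarrow> (real \<Rightarrow> real) \<Rightarrow> real \<Rightarrow> real" where
  "caputo_integral \<nu> v t = integral {0..t} (\<lambda>s. (v s - v 0) / (t - s) powr \<nu>)"

text \<open>
  Functions live on a closed interval \<open>[0,T]\<close>; values outside it are irrelevant. The derivative
  is therefore taken within \<open>[0,T]\<close>: two-sided for \<open>0 < t < T\<close>, left-sided at \<open>t = T\<close>.
  The value at \<open>t = 0\<close> is the limit from the right.
\<close>

definition caputo_pos :: "real \<Rightarrow> real \<Rightarrow> (real \<Rightarrow> real) \<Rightarrow> real \<Rightarrow> real" where
  "caputo_pos T \<nu> v t =
     1 / Gamma (1 - \<nu>) * vector_derivative (caputo_integral \<nu> v) (at t within {0..T})"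

definition caputo :: "real \<Rightarrow> real \<Rightarrow> (real \<Rightarrow> real) \<Rightarrow> real \<Rightarrow> real" where
  "caputo T \<nu> v t =
     (if t = 0 then Lim (at_right 0) (caputo_pos T \<nu> v) else caputo_pos T \<nu> v t)"

text \<open>
  Existence of the limit at \<open>0\<close> is part of the continuity at \<open>0\<close>; differentiability has
  to be required separately, since \<^const>\<open>vector_derivative\<close> is total.
\<close>

definition caputo_continuous :: "real \<Rightarrow> real \<Rightarrow> (real \<Rightarrow> real) \<Rightarrow> bool" where
  "caputo_continuous T \<nu> v \<longleftrightarrow>
     (\<forall>t\<in>{0<..T}. caputo_integral \<nu> v differentiable (at t within {0..T})) \<and>
     continuous_on {0..T} (caputo T \<nu> v)"

definition sup_norm :: "real \<Rightarrow> (real \<Rightarrow> real) \<Rightarrow> ennreal" where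
  "sup_norm T f = (SUP t\<in>{0..T}. ennreal \<bar>f t\<bar>)"

definition holder_seminorm :: "real \<Rightarrow> real \<Rightarrow> (real \<Rightarrow> real) \<Rightarrow> ennreal" where
  "holder_seminorm \<alpha> T f =
     (SUP (s, t)\<in>{(s, t). s \<in> {0..T} \<and> t \<in> {0..T} \<and> s \<noteq> t}.
        ennreal (\<bar>f s - f t\<bar> / \<bar>s - t\<bar> powr \<alpha>))"

definition holder_space :: "real \<Rightarrow> real \<Rightarrow> (real \<Rightarrow> real) set" where
  "holder_space \<alpha> T = {f. continuous_on {0..T} f \<and> holder_seminorm \<alpha> T f < \<infinity>}"

definition frac_holder_norm :: "real \<Rightarrow> real \<Rightarrow> real \<Rightarrow> (real \<Rightarrow> real) \<Rightarrow> ennreal" where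
  "frac_holder_norm \<alpha> \<nu> T v =
     sup_norm T v + sup_norm T (caputo T \<nu> v) + holder_seminorm \<alpha> T (caputo T \<nu> v)"

definition frac_holder_space :: "real \<Rightarrow> real \<Rightarrow> real \<Rightarrow> (real \<Rightarrow> real) set" where
  "frac_holder_space \<alpha> \<nu> T =
     {v. continuous_on {0..T} v \<and> caputo_continuous T \<nu> v \<and> frac_holder_norm \<alpha> \<nu> T v < \<infinity>}"

definition frac_op_I ::
    "real \<Rightarrow> nat \<Rightarrow> (nat \<Rightarrow> real \<Rightarrow> real) \<Rightarrow> (nat \<Rightarrow> real) \<Rightarrow> (real \<Rightarrow> real) \<Rightarrow> real \<Rightarrow> real" where
  "frac_op_I T M r \<nu> v t = (\<Sum>i=0..M. r i t * caputo T (\<nu> i) v t)"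

end

theory Submission
  imports Defs
begin

text \<open>
  Put \<open>u = v - v 0\<close> and let \<open>g\<close> be the Caputo derivative of order \<open>\<nu>\<^sub>0\<close>. Integrating the definition of
  \<open>g\<close> says that the Abel integral of \<open>u\<close> of order \<open>1 - \<nu>\<^sub>0\<close> is a multiple of the primitive of \<open>g\<close>;
  applying the Abel integral of order \<open>\<nu>\<^sub>0\<close> and the semigroup law shows that \<open>u\<close> and
  \<open>abel \<nu>\<^sub>0 g / \<Gamma>(\<nu>\<^sub>0)\<close> have the same primitive, so they coincide. Hence \<open>u t = O(t powr \<nu>\<^sub>0)\<close>,
  which forces the Caputo derivatives of lower order to vanish at \<open>0\<close>: only the term with index \<open>0\<close>
  survives in the value of the operator at \<open>0\<close>, and \<open>g 0 \<noteq> 0\<close>. Then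
  \<open>u t \<sim> g 0 / \<Gamma>(1 + \<nu>\<^sub>0) * t powr \<nu>\<^sub>0\<close>, and the limit formula follows by l'Hopital's rule.
\<close>

section \<open>Abel integrals\<close>

text \<open>
  The Riemann-Liouville integral of order \<open>a\<close> without its factor \<open>1 / \<Gamma>(a)\<close>. The kernel takes the
  junk value \<open>0 powr (a - 1) = 0\<close> at \<open>s = t\<close>, even for \<open>a = 1\<close>.
\<close>

definition abel :: "real \<Rightarrow> (real \<Rightarrow> real) \<Rightarrow> real \<Rightarrow> real" where
  "abel a f t = integral {0..t} (\<lambda>s. (t - s) powr (a - 1) * f s)"

text \<open>The affine substitution \<open>s = r + (t - r) * x\<close> reduces this to Euler's Beta
  integral. Homogeneity of the two powers contributes \<open>(t - r) powr (a + b - 2)\<close> and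
  the differential one more factor \<open>t - r\<close>. This is the inner integral in the semigroup
  law.\<close>

lemma has_integral_Beta_scaled:
  fixes a b r t :: real
  assumes "0 < a" "0 < b" "r \<le> t"
  shows "((\<lambda>s. (t - s) powr (a - 1) * (s - r) powr (b - 1)) has_integral
           Beta a b * (t - r) powr (a + b - 1)) {r..t}"
proof (cases "r = t")
  case True
  then show ?thesis by (simp add: has_integral_refl)
next
  case False
  define d where "d = t - r"
  have d: "d > 0" using False assms by (simp add: d_def)
  have "((\<lambda>x. x powr (b - 1) * (1 - x) powr (a - 1)) has_integral Beta b a) (cbox 0 1)"
    using has_integral_Beta_real[OF assms(2,1)] by simp
  from has_integral_affinity'[OF this, of "1 / d" "- (r / d)"] d
  have "((\<lambda>s. (s / d - r / d) powr (b - 1) * (1 - (s / d - r / d)) powr (a - 1))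
          has_integral d * Beta b a) {d * (r / d)..d * (1 + r / d)}"
    by simp
  moreover have "d * (r / d) = r" "d * (1 + r / d) = t"
    using d by (auto simp: ring_distribs) (simp add: d_def)
  ultimately have "((\<lambda>s. (s / d - r / d) powr (b - 1) * (1 - (s / d - r / d)) powr (a - 1))
          has_integral Beta b a * d) {r..t}"
    by (simp only: mult.commute)
  then have "((\<lambda>s. d powr (a + b - 2) *
               ((s / d - r / d) powr (b - 1) * (1 - (s / d - r / d)) powr (a - 1)))
          has_integral d powr (a + b - 2) * (Beta b a * d)) {r..t}"
    by (rule has_integral_mult_right)
  moreover have "d powr (a + b - 2) * (Beta b a * d) = Beta a b * d powr (a + b - 1)"
  proof -
    have "d powr (a + b - 1) = d powr (a + b - 2) * d powr 1"
      by (subst powr_add[symmetric]) simp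
    then show ?thesis using d by (simp add: Beta_commute)
  qed
  moreover have "d powr (a + b - 2) *
               ((s / d - r / d) powr (b - 1) * (1 - (s / d - r / d)) powr (a - 1))
             = (t - s) powr (a - 1) * (s - r) powr (b - 1)" if "s \<in> {r..t}" for s
  proof -
    have 1: "s / d - r / d = (s - r) / d" by (simp add: diff_divide_distrib)
    have 2: "1 - (s - r) / d = (t - s) / d" using d by (simp add: field_simps d_def)
    have 3: "d powr (a + b - 2) = d powr (a - 1) * d powr (b - 1)"
      by (subst powr_add[symmetric]) (simp add: algebra_simps)
    show ?thesis
      unfolding 1 2 3 using that d by (simp add: powr_divide)
  qed
  ultimately show ?thesis
    unfolding d_def[symmetric] by (smt (verit, ccfv_SIG) has_integral_cong)
qed

lemma Beta_1_right:
  fixes a :: real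
  assumes "0 < a"
  shows "Beta a 1 = 1 / a"
  using assms less_imp_neq[OF Gamma_real_pos[OF assms]] Gamma_plus1[of a]
  by (simp add: Beta_def nonpos_Ints_def)

lemma has_integral_abel_kernel:
  fixes a t :: real
  assumes "0 < a" "0 \<le> t"
  shows "((\<lambda>s. (t - s) powr (a - 1)) has_integral t powr a / a) {0..t}"
\<comment> \<open>Take \<open>b = 1\<close> in the Beta integral. The extra factor
  \<open>(s - 0) powr 0\<close> is 1 except at \<open>s = 0\<close>, where
  \<open>0 powr 0 = 0\<close>; hence the exceptional point.\<close>
proof (rule has_integral_spike[of "{0}"])
  show "((\<lambda>s. (t - s) powr (a - 1) * (s - 0) powr (1 - 1)) has_integral t powr a / a) {0..t}"
    using has_integral_Beta_scaled[of a 1 0 t] assms Beta_1_right[of a] by simp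
qed auto

text \<open>The kernel is nonnegative with finite integral, hence absolutely integrable, and a
  continuous factor on a compact interval is bounded and measurable. The absolute version is what
  Fubini's theorem requires later.\<close>

lemma absolutely_integrable_abel:
  fixes a t :: real and f :: "real \<Rightarrow> real"
  assumes "0 < a" "continuous_on {0..t} f"
  shows "(\<lambda>s. (t - s) powr (a - 1) * f s) absolutely_integrable_on {0..t}"
proof (cases "0 \<le> t")
  case True
  have "(\<lambda>s. (t - s) powr (a - 1)) absolutely_integrable_on {0..t}"
    using has_integral_abel_kernel[OF assms(1) True]
    by (intro nonnegative_absolutely_integrable_1) auto
  then have "(\<lambda>s. f s * (t - s) powr (a - 1)) absolutely_integrable_on {0..t}"
    using assms(2)
    by (intro absolutely_integrable_bounded_measurable_product_real
          continuous_imp_measurable_on_sets_lebesgue compact_imp_bounded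
          compact_continuous_image) auto
  then show ?thesis by (simp add: mult.commute)
qed auto

lemma integrable_abel:
  fixes a t :: real and f :: "real \<Rightarrow> real"
  assumes "0 < a" "continuous_on {0..t} f"
  shows "(\<lambda>s. (t - s) powr (a - 1) * f s) integrable_on {0..t}"
  using absolutely_integrable_abel[OF assms] set_lebesgue_integral_eq_integral(1) by blast

lemma abel_bound:
  assumes "0 < a" "0 \<le> t" "continuous_on {0..t} f" "\<And>s. s \<in> {0..t} \<Longrightarrow> \<bar>f s\<bar> \<le> C"
  shows "\<bar>abel a f t\<bar> \<le> C * (t powr a / a)"
proof -
  have "((\<lambda>s. C * (t - s) powr (a - 1)) has_integral C * (t powr a / a)) {0..t}"
    by (intro has_integral_mult_right has_integral_abel_kernel assms)
  moreover have "norm ((t - s) powr (a - 1) * f s) \<le> C * (t - s) powr (a - 1)" if "s \<in> {0..t}" for s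
    using assms(4)[OF that] by (simp add: abs_mult mult_right_mono mult.commute)
  ultimately have "norm (abel a f t) \<le> C * (t powr a / a)"
    unfolding abel_def
    using Henstock_Kurzweil_Integration.integral_norm_bound_integral[OF integrable_abel[OF assms(1,3)]]
    by (metis (no_types, lifting) has_integral_iff)
  then show ?thesis by simp
qed

lemma abel_const:
  assumes "0 < a" "0 \<le> t"
  shows "abel a (\<lambda>_. c) t = c * (t powr a / a)"
  using has_integral_mult_left[OF has_integral_abel_kernel[OF assms], of c]
  by (simp add: abel_def has_integral_iff mult.commute[of c])

lemma abel_diff:
  assumes "0 < a" "continuous_on {0..t} f" "continuous_on {0..t} g"
  shows "abel a (\<lambda>s. f s - g s) t = abel a f t - abel a g t"
  unfolding abel_def
  by (simp add: right_diff_distrib Henstock_Kurzweil_Integration.integral_diff integrable_abel assms)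

lemma abel_cmult: "abel a (\<lambda>s. c * f s) t = c * abel a f t"
  unfolding abel_def by (simp add: mult.left_commute)

lemma abel_cong: "(\<And>s. s \<in> {0..t} \<Longrightarrow> f s = g s) \<Longrightarrow> abel a f t = abel a g t"
  unfolding abel_def by (intro Henstock_Kurzweil_Integration.integral_cong) auto

lemma abel_1: "abel 1 f t = integral {0..t} f"
  unfolding abel_def
  by (rule integral_spike[of "{t}"]) auto

section \<open>Rescaling to the unit interval, and continuity of Abel integrals\<close>

lemma abel_rescale:
  assumes "0 < a" "0 \<le> t"
  shows "abel a f t = t powr a * abel a (\<lambda>x. f (t * x)) 1"
proof (cases "t = 0")
  case False
  with assms have t: "t > 0" by simp
  have "(1 / t) * abel a f t = integral {0..1} (\<lambda>x. (t - t * x) powr (a - 1) * f (t * x))"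
    unfolding abel_def using t
      integral_stretch_real[of t 0 t "\<lambda>s. (t - s) powr (a - 1) * f s"]
    by (simp add: image_divide_atLeastAtMost)
  also have "\<dots> = integral {0..1} (\<lambda>x. t powr (a - 1) * ((1 - x) powr (a - 1) * f (t * x)))"
  proof (rule Henstock_Kurzweil_Integration.integral_cong)
    fix x :: real assume "x \<in> {0..1}"
    moreover have "t - t * x = t * (1 - x)" by (simp add: algebra_simps)
    ultimately show "(t - t * x) powr (a - 1) * f (t * x) =
        t powr (a - 1) * ((1 - x) powr (a - 1) * f (t * x))"
      using t by (simp add: powr_mult)
  qed
  also have "\<dots> = t powr (a - 1) * abel a (\<lambda>x. f (t * x)) 1"
    by (simp add: abel_def)
  finally show ?thesis using t by (simp add: field_simps powr_diff)
qed (simp add: abel_def)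

text \<open>After rescaling, neither the singular weight nor the domain depends on \<open>t\<close>,
  so uniform continuity of \<open>f\<close> passes directly to the integral.\<close>

lemma continuous_on_abel_rescaled:
  assumes "0 < a" "continuous_on {0..T} f"
  shows "continuous_on {0..T} (\<lambda>t. abel a (\<lambda>x. f (t * x)) 1)"
proof -
  let ?W = "\<lambda>t. abel a (\<lambda>x. f (t * x)) 1"
  have mem: "t * x \<in> {0..T}" if "t \<in> {0..T}" "x \<in> {0..1}" for t x :: real
    using that mult_left_le[of x t] by auto
  have cont: "continuous_on {0..1} (\<lambda>x. f (t * x))" if "t \<in> {0..T}" for t
    using that mem by (intro continuous_on_compose2[OF assms(2)] continuous_intros) auto
  show "continuous_on {0..T} ?W"
    unfolding continuous_on_iff
  proof (intro ballI allI impI)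
    fix t e :: real assume t: "t \<in> {0..T}" and e: "0 < e"
    have "uniformly_continuous_on {0..T} f"
      using assms(2) compact_Icc by (rule compact_uniformly_continuous)
    \<comment> \<open>The weight has total mass \<open>1 / a\<close> on the unit interval, so the
      tolerance \<open>e * a / 2\<close> for \<open>f\<close> becomes \<open>e / 2\<close> for the
      integral.\<close>
    then obtain d where d: "d > 0"
      "\<And>x y. x \<in> {0..T} \<Longrightarrow> y \<in> {0..T} \<Longrightarrow> dist y x < d \<Longrightarrow> dist (f y) (f x) < e * a / 2"
      unfolding uniformly_continuous_on_def using e assms(1)
      by (metis half_gt_zero mult_pos_pos)
    have "dist (?W t') (?W t) < e" if t': "t' \<in> {0..T}" "dist t' t < d" for t'
    proof -
      have "\<bar>f (t' * x) - f (t * x)\<bar> \<le> e * a / 2" if x: "x \<in> {0..1}" for x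
      proof -
        have "\<bar>t' * x - t * x\<bar> = \<bar>t' - t\<bar> * x"
          using x by (simp add: abs_mult flip: left_diff_distrib)
        also have "\<dots> \<le> \<bar>t' - t\<bar>" using x by (simp add: mult_left_le)
        finally have "dist (t' * x) (t * x) < d" using t' by (simp add: dist_real_def)
        from d(2)[OF mem[OF t x] mem[OF t'(1) x] this] show ?thesis
          by (simp add: dist_real_def)
      qed
      then have "\<bar>abel a (\<lambda>x. f (t' * x) - f (t * x)) 1\<bar> \<le> e * a / 2 * (1 powr a / a)"
        using assms(1) t t' by (intro abel_bound continuous_intros cont) auto
      also have "\<dots> < e" using assms(1) e by simp
      finally show ?thesis
        using assms(1) t t' by (simp add: abel_diff cont dist_real_def)
    qed
    with d(1) show "\<exists>d>0. \<forall>t'\<in>{0..T}. dist t' t < d \<longrightarrow> dist (?W t') (?W t) < e"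
      by blast
  qed
qed

lemma continuous_on_abel:
  assumes "0 < a" "continuous_on {0..T} f"
  shows "continuous_on {0..T} (abel a f)"
proof -
  have "continuous_on {0..T} (\<lambda>t. t powr a * abel a (\<lambda>x. f (t * x)) 1)"
    using assms by (intro continuous_on_mult continuous_on_abel_rescaled continuous_on_powr' continuous_intros) auto
  then show ?thesis
    by (rule continuous_on_eq) (use abel_rescale[OF assms(1), symmetric] in auto)
qed

section \<open>The semigroup law of Abel integrals\<close>

lemma lborel_integral_Icc:
  fixes g :: "real \<Rightarrow> real"
  assumes "g absolutely_integrable_on {c..d}"
    and "(\<lambda>x. if x \<in> {c..d} then g x else 0) \<in> borel_measurable borel"
  shows "integrable lborel (\<lambda>x. if x \<in> {c..d} then g x else 0)"
    and "(\<integral>x. (if x \<in> {c..d} then g x else 0) \<partial>lborel) = integral {c..d} g"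
proof -
  have eq: "(\<lambda>x. indicator {c..d} x *\<^sub>R g x) = (\<lambda>x. if x \<in> {c..d} then g x else 0)"
    by (auto simp: indicator_def)
  \<comment> \<open>Absolute integrability refers to the completed Lebesgue measure; Borel
    measurability of the integrand allows the descent to \<open>lborel\<close>, over which Fubini is
    applied.\<close>
  show int: "integrable lborel (\<lambda>x. if x \<in> {c..d} then g x else 0)"
    using assms unfolding set_integrable_def eq
    by (subst (asm) integrable_completion) auto
  show "(\<integral>x. (if x \<in> {c..d} then g x else 0) \<partial>lborel) = integral {c..d} g"
    using integral_lborel[OF int] integral_restrict_UNIV[of "{c..d}" g] by simp
qed

text \<open>Interchange the order of integration over the triangle
  \<open>0 \<le> r \<le> s \<le> t\<close>: the integral over \<open>s\<close> is then a Beta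
  integral in \<open>(t - s)\<close> and \<open>(s - r)\<close>, which leaves a kernel of order
  \<open>a + b\<close>.\<close>

lemma abel_abel:
  assumes ab: "0 < a" "0 < b" and f: "continuous_on {0..t} f"
  shows "abel a (abel b f) t = Beta a b * abel (a + b) f t"
proof -
  \<comment> \<open>\<open>h\<close> extends \<open>f\<close> by its endpoint values, which makes it
    continuous on the whole line and hence Borel; \<open>k\<close> is the integrand on the triangle,
    extended by 0 to the plane.\<close>
  define h where "h r = f (max 0 (min t r))" for r
  define k where "k r s = (if 0 \<le> r \<and> r \<le> s \<and> s \<le> t
      then (t - s) powr (a - 1) * (s - r) powr (b - 1) * h r else 0)" for r s
  show ?thesis
  proof (cases "0 \<le> t")
    case t: True
    have hf: "h r = f r" if "r \<in> {0..t}" for r using that by (simp add: h_def)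
    have "continuous_on UNIV h"
      unfolding h_def using t by (intro continuous_on_compose2[OF f] continuous_intros) auto
    then have [measurable]: "h \<in> borel_measurable borel"
      by (rule borel_measurable_continuous_onI)
    have kmeas [measurable]: "case_prod k \<in> borel_measurable (lborel \<Otimes>\<^sub>M lborel)"
      unfolding k_def by measurable
    \<comment> \<open>For fixed \<open>r\<close>: integrability of the section, its integral, and
      its L1 norm. The norm enters the integrability criterion of Fubini, the integral the final
      value.\<close>
    have k1: "integrable lborel (k r)"
      "(\<integral>s. k r s \<partial>lborel) = (if r \<in> {0..t} then (t - r) powr (a + b - 1) * (Beta a b * h r) else 0)"
      "(\<integral>s. norm (k r s) \<partial>lborel) =
        (if r \<in> {0..t} then (t - r) powr (a + b - 1) * (Beta a b * \<bar>h r\<bar>) else 0)" for r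
    proof -
      have *: "integrable lborel (k r) \<and>
        (\<integral>s. k r s \<partial>lborel) = (t - r) powr (a + b - 1) * (Beta a b * h r) \<and>
        (\<integral>s. norm (k r s) \<partial>lborel) = (t - r) powr (a + b - 1) * (Beta a b * \<bar>h r\<bar>)"
        if r: "r \<in> {0..t}"
      proof -
        let ?p = "\<lambda>s. (t - s) powr (a - 1) * (s - r) powr (b - 1)"
        have p: "(?p has_integral Beta a b * (t - r) powr (a + b - 1)) {r..t}"
          using has_integral_Beta_scaled[OF ab] r by auto
        have pa: "?p absolutely_integrable_on {r..t}"
          using p by (intro nonnegative_absolutely_integrable_1) auto
        have pm: "(\<lambda>s. if s \<in> {r..t} then ?p s else 0) \<in> borel_measurable borel"
          by measurable
        have k: "k r = (\<lambda>s. h r * (if s \<in> {r..t} then ?p s else 0))"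
          "(\<lambda>s. norm (k r s)) = (\<lambda>s. \<bar>h r\<bar> * (if s \<in> {r..t} then ?p s else 0))"
          using r by (auto simp: k_def fun_eq_iff abs_mult)
        show ?thesis
          unfolding k(2) unfolding k(1) using lborel_integral_Icc[OF pa pm] p
          by (simp add: has_integral_iff)
      qed
      moreover have "k r = (\<lambda>_. 0)" if "r \<notin> {0..t}"
        using that by (auto simp: k_def)
      ultimately show "integrable lborel (k r)"
        "(\<integral>s. k r s \<partial>lborel) = (if r \<in> {0..t} then (t - r) powr (a + b - 1) * (Beta a b * h r) else 0)"
        "(\<integral>s. norm (k r s) \<partial>lborel) =
          (if r \<in> {0..t} then (t - r) powr (a + b - 1) * (Beta a b * \<bar>h r\<bar>) else 0)"
        by (cases "r \<in> {0..t}"; simp)+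
    qed
    have hc: "continuous_on {0..s} h" for s
      using \<open>continuous_on UNIV h\<close> continuous_on_subset by blast
    \<comment> \<open>The L1 norms of the sections form an Abel integrand of order
      \<open>a + b\<close> with continuous density, so they are integrable in
      \<open>r\<close>.\<close>
    have outer: "integrable lborel (\<lambda>r. if r \<in> {0..t} then (t - r) powr (a + b - 1) * (Beta a b * \<bar>h r\<bar>) else 0)"
      using ab by (intro lborel_integral_Icc absolutely_integrable_abel continuous_intros hc) auto
    have "integrable (lborel \<Otimes>\<^sub>M lborel) (case_prod k)"
      by (rule lborel_pair.Fubini_integrable) (use k1 outer in auto)
    note Fubini = lborel_pair.Fubini_integral[OF this]
    have "(\<integral>r. (\<integral>s. k r s \<partial>lborel) \<partial>lborel) = integral {0..t} (\<lambda>r. (t - r) powr (a + b - 1) * (Beta a b * h r))"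
      unfolding k1(2) using ab
      by (intro lborel_integral_Icc absolutely_integrable_abel continuous_intros hc) auto
    also have "\<dots> = integral {0..t} (\<lambda>r. Beta a b * ((t - r) powr (a + b - 1) * f r))"
      by (intro Henstock_Kurzweil_Integration.integral_cong) (simp add: hf)
    also have "\<dots> = Beta a b * abel (a + b) f t"
      by (simp add: abel_def)
    finally have rhs: "(\<integral>r. (\<integral>s. k r s \<partial>lborel) \<partial>lborel) = Beta a b * abel (a + b) f t" .
    have inner: "(\<integral>r. k r s \<partial>lborel) = (if s \<in> {0..t} then (t - s) powr (a - 1) * abel b f s else 0)" for s
    proof (cases "s \<in> {0..t}")
      case True
      have "(\<lambda>r. k r s) = (\<lambda>r. (t - s) powr (a - 1) * (if r \<in> {0..s} then (s - r) powr (b - 1) * h r else 0))"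
        using True by (auto simp: k_def fun_eq_iff)
      moreover have "(\<integral>r. (if r \<in> {0..s} then (s - r) powr (b - 1) * h r else 0) \<partial>lborel) = abel b h s"
        unfolding abel_def using ab
        by (intro lborel_integral_Icc absolutely_integrable_abel hc) auto
      moreover have "abel b h s = abel b f s"
        using True by (intro abel_cong hf) auto
      ultimately show ?thesis using True by simp
    next
      case False
      then have "(\<lambda>r. k r s) = (\<lambda>_. 0)" by (auto simp: k_def)
      then show ?thesis unfolding if_not_P[OF False] by simp
    qed
    \<comment> \<open>Reading \<open>inner\<close> backwards presents the function as a parameter
      integral of the jointly measurable \<open>k\<close>, which yields its Borel
      measurability.\<close>
    have meas: "(\<lambda>s. if s \<in> {0..t} then (t - s) powr (a - 1) * abel b f s else 0) \<in> borel_measurable borel"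
      unfolding inner[symmetric]
      using lborel.borel_measurable_lebesgue_integral[of "\<lambda>s r. k r s" borel] by measurable
    have "(\<integral>s. (\<integral>r. k r s \<partial>lborel) \<partial>lborel) = abel a (abel b f) t"
      unfolding inner abel_def[of a]
      using ab f meas by (intro lborel_integral_Icc absolutely_integrable_abel continuous_on_abel) auto
    with Fubini rhs show ?thesis by simp
  qed (simp add: abel_def)
qed

section \<open>Caputo derivatives\<close>

lemma caputo_integral_eq_abel:
  "caputo_integral \<nu> v t = abel (1 - \<nu>) (\<lambda>s. v s - v 0) t"
  unfolding caputo_integral_def abel_def by (simp add: powr_minus_divide)

text \<open>This is the fundamental theorem of calculus for \<open>caputo_integral\<close>. Its
  interior version asks only for continuity at the endpoints, so no derivative at 0 is involved,
  where \<open>caputo\<close> is defined as a limit. The boundary term at 0 is an integral over a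
  single point.\<close>

lemma abel_eq_integral_caputo:
  assumes \<nu>: "\<nu> < 1" and v: "continuous_on {0..T} v" and D: "caputo_continuous T \<nu> v"
    and t: "t \<in> {0..T}"
  shows "abel (1 - \<nu>) (\<lambda>s. v s - v 0) t = Gamma (1 - \<nu>) * integral {0..t} (caputo T \<nu> v)"
proof -
  let ?F = "caputo_integral \<nu> v"
  have Feq: "?F = abel (1 - \<nu>) (\<lambda>s. v s - v 0)"
    by (simp add: fun_eq_iff caputo_integral_eq_abel)
  have "continuous_on {0..t} ?F"
    unfolding Feq using \<nu> t
    by (intro continuous_on_abel continuous_intros continuous_on_subset[OF v]) auto
  moreover have "(?F has_vector_derivative Gamma (1 - \<nu>) * caputo T \<nu> v x) (at x)" if x: "x \<in> {0<..<t}" for x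
  proof -
    have "?F differentiable (at x within {0..T})"
      using D x t by (auto simp: caputo_continuous_def)
    then have "(?F has_vector_derivative vector_derivative ?F (at x within {0..T})) (at x within {0..T})"
      by (simp add: vector_derivative_works)
    moreover have "vector_derivative ?F (at x within {0..T}) = Gamma (1 - \<nu>) * caputo T \<nu> v x"
      using x less_imp_neq[OF Gamma_real_pos[of "1 - \<nu>"]] \<nu> by (simp add: caputo_def caputo_pos_def)
    moreover have "at x within {0..T} = at x"
      using x t by (intro at_within_Icc_at) auto
    ultimately show ?thesis by simp
  qed
  ultimately have "((\<lambda>x. Gamma (1 - \<nu>) * caputo T \<nu> v x) has_integral ?F t - ?F 0) {0..t}"
    using t by (intro fundamental_theorem_of_calculus_interior) auto
  then have "integral {0..t} (\<lambda>x. Gamma (1 - \<nu>) * caputo T \<nu> v x) = ?F t - ?F 0"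
    by (rule integral_unique)
  then show ?thesis by (simp add: Feq) (simp add: abel_def)
qed

text \<open>Comparing primitives avoids differentiating a singular integral: both sides are
  continuous, so equal primitives on the interval force equal values.\<close>

theorem caputo_inversion:
  assumes \<nu>: "0 < \<nu>" "\<nu> < 1" and v: "continuous_on {0..T} v" and D: "caputo_continuous T \<nu> v"
    and t: "0 < T" "t \<in> {0..T}"
  shows "v t - v 0 = abel \<nu> (caputo T \<nu> v) t / Gamma \<nu>"
proof -
  let ?u = "\<lambda>s. v s - v 0" and ?g = "caputo T \<nu> v"
  have g: "continuous_on {0..T} ?g" using D by (simp add: caputo_continuous_def)
  have u: "continuous_on {0..T} ?u" by (intro continuous_intros v)
  have \<Gamma>: "Gamma \<nu> > 0" "Gamma (1 - \<nu>) > 0" using \<nu> by (auto intro: Gamma_real_pos)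
  have primitives: "integral {0..s} ?u = integral {0..s} (\<lambda>x. abel \<nu> ?g x / Gamma \<nu>)"
    if s: "s \<in> {0..T}" for s
  proof -
    have sub: "continuous_on {0..s} ?u" "continuous_on {0..s} ?g"
      using s by (auto intro: continuous_on_subset[OF u] continuous_on_subset[OF g])
    \<comment> \<open>The orders \<open>\<nu>\<close> and \<open>1 - \<nu>\<close> add up to 1, and
      \<open>Beta \<nu> (1 - \<nu>)\<close> is the product of the two Gamma values because
      \<open>Gamma 1 = 1\<close>.\<close>
    have "Gamma \<nu> * Gamma (1 - \<nu>) * integral {0..s} ?u = abel \<nu> (abel (1 - \<nu>) ?u) s"
      using abel_abel[OF \<nu>(1) _ sub(1), of "1 - \<nu>"] \<nu> by (simp add: abel_1 Beta_def)
    also have "\<dots> = abel \<nu> (\<lambda>x. Gamma (1 - \<nu>) * abel 1 ?g x) s"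
      using s by (intro abel_cong) (simp add: abel_eq_integral_caputo[OF \<nu>(2) v D] abel_1)
    \<comment> \<open>Abel integrals of orders \<open>\<nu>\<close> and 1 commute: the semigroup law
      gives the same right-hand side for both compositions.\<close>
    also have "\<dots> = Gamma (1 - \<nu>) * abel 1 (abel \<nu> ?g) s"
      using abel_abel[OF \<nu>(1) zero_less_one sub(2)] abel_abel[OF zero_less_one \<nu>(1) sub(2)]
      by (simp add: abel_cmult Beta_commute add.commute)
    finally show ?thesis using \<Gamma> by (simp add: abel_1 field_simps)
  qed
  have "((\<lambda>s. integral {0..s} ?u) has_vector_derivative ?u t) (at t within {0..T})"
    by (rule integral_has_vector_derivative[OF u t(2)])
  moreover have "((\<lambda>s. integral {0..s} (\<lambda>x. abel \<nu> ?g x / Gamma \<nu>)) has_vector_derivative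
      abel \<nu> ?g t / Gamma \<nu>) (at t within {0..T})"
    using \<Gamma> by (intro integral_has_vector_derivative t continuous_intros continuous_on_abel \<nu> g) auto
  then have "((\<lambda>s. integral {0..s} ?u) has_vector_derivative abel \<nu> ?g t / Gamma \<nu>) (at t within {0..T})"
    by (rule has_vector_derivative_transform[rotated 2]) (use t primitives in auto)
  ultimately show ?thesis
    using vector_derivative_unique_within_closed_interval[of 0 T t] t by auto
qed

section \<open>Behaviour at 0 from the right\<close>

lemma tendsto_integral_average_at_right:
  fixes g :: "real \<Rightarrow> real"
  assumes "0 < T" "continuous_on {0..T} g"
  shows "((\<lambda>t. integral {0..t} g / t) \<longlongrightarrow> g 0) (at_right 0)"
proof -
  have "((\<lambda>t. integral {0..t} g) has_real_derivative g 0) (at 0 within {0..T})"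
    using integral_has_vector_derivative[OF assms(2), of 0] assms(1)
    by (simp add: has_real_derivative_iff_has_vector_derivative)
  then show ?thesis
    using assms(1) by (simp add: has_field_derivative_iff at_within_Icc_at_right)
qed

text \<open>The Abel integral of order \<open>1 - \<nu>\<close> of a function that is
  \<open>O(t powr \<mu>)\<close> is \<open>O(t powr (\<mu> + 1 - \<nu>))\<close>. Hence the mean of
  the Caputo derivative over \<open>{0..t}\<close> is \<open>O(t powr (\<mu> - \<nu>))\<close> and
  tends to 0, while by continuity it also tends to the value at 0.\<close>

lemma caputo_0_eq_0:
  assumes \<nu>: "\<nu> < 1" "\<nu> < \<mu>" "0 < \<mu>" and T: "0 < T" and v: "continuous_on {0..T} v"
    and D: "caputo_continuous T \<nu> v"
    and bound: "\<And>t. t \<in> {0..T} \<Longrightarrow> \<bar>v t - v 0\<bar> \<le> C * t powr \<mu>"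
  shows "caputo T \<nu> v 0 = 0"
proof -
  let ?g = "caputo T \<nu> v"
  have \<Gamma>: "Gamma (1 - \<nu>) > 0" using \<nu> by (auto intro: Gamma_real_pos)
  \<comment> \<open>The sign of \<open>C\<close> is read off from the bound at \<open>T\<close>; it
    makes \<open>C * s powr \<mu>\<close> monotone in \<open>s\<close>, so its value at
    \<open>t\<close> bounds the density on \<open>{0..t}\<close>.\<close>
  have "0 \<le> C * T powr \<mu>" using bound[of T] T by auto
  then have C: "0 \<le> C" using T by (simp add: zero_le_mult_iff)
  define K where "K = C / (1 - \<nu>) / Gamma (1 - \<nu>)"
  have "norm (integral {0..t} ?g / t) \<le> K * t powr (\<mu> - \<nu>)" if t: "t \<in> {0<..<T}" for t
  proof -
    have "\<bar>abel (1 - \<nu>) (\<lambda>s. v s - v 0) t\<bar> \<le> (C * t powr \<mu>) * (t powr (1 - \<nu>) / (1 - \<nu>))"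
    proof (rule abel_bound)
      show "continuous_on {0..t} (\<lambda>s. v s - v 0)"
        using t by (intro continuous_intros continuous_on_subset[OF v]) auto
      show "\<bar>v s - v 0\<bar> \<le> C * t powr \<mu>" if s: "s \<in> {0..t}" for s
        using bound[of s] s t C \<nu> by (smt (verit) mult_left_mono powr_mono2 atLeastAtMost_iff greaterThanLessThan_iff)
    qed (use \<nu> t in auto)
    then have "Gamma (1 - \<nu>) * \<bar>integral {0..t} ?g\<bar> \<le> C / (1 - \<nu>) * (t powr \<mu> * t powr (1 - \<nu>))"
      using t \<Gamma> by (simp add: abel_eq_integral_caputo[OF \<nu>(1) v D] abs_mult)
    also have "t powr \<mu> * t powr (1 - \<nu>) = t * t powr (\<mu> - \<nu>)"
      using t powr_add[of t "\<mu>" "1 - \<nu>"] powr_add[of t 1 "\<mu> - \<nu>"] by (simp add: algebra_simps)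
    finally have "Gamma (1 - \<nu>) * \<bar>integral {0..t} ?g\<bar> \<le> C / (1 - \<nu>) * (t * t powr (\<mu> - \<nu>))" .
    then have "\<bar>integral {0..t} ?g\<bar> \<le> C / (1 - \<nu>) * (t * t powr (\<mu> - \<nu>)) / Gamma (1 - \<nu>)"
      by (simp only: pos_le_divide_eq[OF \<Gamma>] mult.commute)
    also have "\<dots> = K * t powr (\<mu> - \<nu>) * t"
      by (simp add: K_def)
    finally have "\<bar>integral {0..t} ?g\<bar> \<le> K * t powr (\<mu> - \<nu>) * t" .
    then show ?thesis
      using t by (simp add: pos_divide_le_eq abs_divide)
  qed
  then have "eventually (\<lambda>t. norm (integral {0..t} ?g / t) \<le> K * t powr (\<mu> - \<nu>)) (at_right 0)"
    using T by (auto simp: eventually_at_right_field)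
  moreover have "((\<lambda>t. t powr (\<mu> - \<nu>)) \<longlongrightarrow> 0 powr (\<mu> - \<nu>)) (at_right 0)"
    using \<nu> by (intro tendsto_powr') (auto simp: eventually_at_right_field intro: exI[of _ 1])
  then have "((\<lambda>t. K * t powr (\<mu> - \<nu>)) \<longlongrightarrow> 0) (at_right 0)"
    using tendsto_mult_right_zero by fastforce
  ultimately have "((\<lambda>t. integral {0..t} ?g / t) \<longlongrightarrow> 0) (at_right 0)"
    by (rule Lim_null_comparison)
  moreover have "((\<lambda>t. integral {0..t} ?g / t) \<longlongrightarrow> ?g 0) (at_right 0)"
    using T D by (intro tendsto_integral_average_at_right) (auto simp: caputo_continuous_def)
  ultimately show ?thesis
    using tendsto_unique trivial_limit_at_right_real by blast
qed

text \<open>For \<open>t > 0\<close> the quotient is the rescaled integral, which is continuous at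
  \<open>t = 0\<close>; there its density is the constant \<open>g 0\<close>.\<close>

lemma tendsto_abel_powr_at_right:
  assumes "0 < a" "0 < T" "continuous_on {0..T} g"
  shows "((\<lambda>t. abel a g t / t powr a) \<longlongrightarrow> g 0 / a) (at_right 0)"
proof -
  let ?W = "\<lambda>t. abel a (\<lambda>x. g (t * x)) 1"
  have "(?W \<longlongrightarrow> ?W 0) (at 0 within {0..T})"
    using continuous_on_abel_rescaled[OF assms(1,3)] assms(2)
    unfolding continuous_on_def by (elim ballE[of _ _ 0]) auto
  then have "(?W \<longlongrightarrow> g 0 / a) (at_right 0)"
    using assms by (simp add: at_within_Icc_at_right abel_const)
  then show ?thesis
    by (rule Lim_transform_eventually)
       (auto simp: eventually_at_right_field abel_rescale[OF assms(1), of _ g] intro: exI[of _ 1])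
qed

text \<open>By l'Hopital the primitive of \<open>u\<close> behaves like
  \<open>c / (a + 1) * t powr (a + 1)\<close>. Dividing the two asymptotics cancels
  \<open>c\<close>, which is legitimate because \<open>c \<noteq> 0\<close>.\<close>

lemma tendsto_integral_ratio_powr:
  fixes u :: "real \<Rightarrow> real"
  assumes "0 < a" "0 < T" and u: "continuous_on {0..T} u"
    and lim: "((\<lambda>t. u t / t powr a) \<longlongrightarrow> c) (at_right 0)" and "c \<noteq> 0"
  shows "((\<lambda>t. t * u t / integral {0..t} u) \<longlongrightarrow> a + 1) (at_right 0)"
proof -
  have pos: "eventually (\<lambda>t. 0 < t) (at_right (0::real))"
    by (simp add: eventually_at_right_less)
  have "((\<lambda>t. integral {0..t} u / t powr (a + 1)) \<longlongrightarrow> c / (a + 1)) (at_right 0)"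
  proof (rule lhopital_right_0)
    have "((\<lambda>t. integral {0..t} u) \<longlongrightarrow> integral {0..0} u) (at 0 within {0..T})"
      using indefinite_integral_continuous_1[OF integrable_continuous_real[OF u]] assms(2)
      unfolding continuous_on_def by (elim ballE[of _ _ 0]) auto
    then show "((\<lambda>t. integral {0..t} u) \<longlongrightarrow> 0) (at_right 0)"
      using assms(2) by (simp add: at_within_Icc_at_right)
    have "((\<lambda>t. t powr (a + 1)) \<longlongrightarrow> 0 powr (a + 1)) (at_right 0)"
      using assms by (intro tendsto_powr') (auto simp: eventually_at_right_field intro: exI[of _ 1])
    then show "((\<lambda>t. t powr (a + 1)) \<longlongrightarrow> 0) (at_right 0)" by simp
    show "\<forall>\<^sub>F t in at_right 0. t powr (a + 1) \<noteq> 0"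
      using pos by eventually_elim auto
    show "\<forall>\<^sub>F t in at_right 0. (a + 1) * t powr a \<noteq> 0"
      using pos by eventually_elim (use assms in auto)
    show "\<forall>\<^sub>F t in at_right 0. ((\<lambda>t. integral {0..t} u) has_real_derivative u t) (at t)"
      unfolding eventually_at_right_field
    proof (intro exI[of _ T] conjI allI impI)
      fix t assume "0 < t" "t < T"
      then show "((\<lambda>t. integral {0..t} u) has_real_derivative u t) (at t)"
        using integral_has_vector_derivative[OF u, of t] at_within_Icc_at[of 0 t T]
        by (simp add: has_real_derivative_iff_has_vector_derivative)
    qed (use assms in auto)
    show "\<forall>\<^sub>F t in at_right 0. ((\<lambda>t. t powr (a + 1)) has_real_derivative (a + 1) * t powr a) (at t)"
      using pos
    proof eventually_elim
      case (elim t)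
      then show ?case by (auto intro!: derivative_eq_intros)
    qed
    have "((\<lambda>t. u t / t powr a / (a + 1)) \<longlongrightarrow> c / (a + 1)) (at_right 0)"
      using assms by (intro tendsto_intros lim) auto
    then show "((\<lambda>t. u t / ((a + 1) * t powr a)) \<longlongrightarrow> c / (a + 1)) (at_right 0)"
      by (simp add: mult.commute)
  qed
  from tendsto_divide[OF lim this] have
    "((\<lambda>t. (u t / t powr a) / (integral {0..t} u / t powr (a + 1))) \<longlongrightarrow> c / (c / (a + 1))) (at_right 0)"
    using assms by auto
  moreover have "c / (c / (a + 1)) = a + 1" using assms by simp
  \<comment> \<open>If the primitive vanished at some \<open>t\<close>, both sides would be 0 by the
    convention for division by zero, so \<open>t > 0\<close> suffices.\<close>
  moreover have "\<forall>\<^sub>F t in at_right 0. (u t / t powr a) / (integral {0..t} u / t powr (a + 1)) =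
      t * u t / integral {0..t} u"
    using pos by eventually_elim (simp add: powr_add)
  ultimately show ?thesis
    by (simp add: Lim_transform_eventually)
qed

section \<open>Recovery of the leading order and the representation of \<open>v\<close>\<close>

theorem theorem3p1:
  fixes T Tstar nustar :: real and M :: nat and \<nu> :: "nat \<Rightarrow> real"
    and r :: "nat \<Rightarrow> real \<Rightarrow> real" and v :: "real \<Rightarrow> real"
  assumes "0 < T" and "1 \<le> M"
    and "0 < \<nu> M" and "\<And>i. i < M \<Longrightarrow> \<nu> (Suc i) < \<nu> i" and "\<nu> 0 < 1"
    and "continuous_on {0..T} v"
    and "\<And>i. i \<le> M \<Longrightarrow> caputo_continuous T (\<nu> i) v"
    and "0 < Tstar" and "Tstar \<le> T" and "0 < nustar" and "nustar < 1"
    and "v \<in> frac_holder_space nustar (\<nu> 0) Tstar"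
    and "\<And>i. i \<le> M \<Longrightarrow> caputo T (\<nu> i) v \<in> holder_space nustar Tstar"
    and "\<And>i. i \<le> M \<Longrightarrow> continuous_on {0..T} (r i)"
    and "\<And>t. t \<in> {0..T} \<Longrightarrow> r 0 t \<noteq> 0"
    and "frac_op_I T M r \<nu> v 0 \<noteq> 0"
  shows "((\<lambda>t. t * (v t - v 0) / integral {0..t} (\<lambda>\<tau>. v \<tau> - v 0) - 1) \<longlongrightarrow> \<nu> 0) (at_right 0) \<and>
    (\<forall>t\<in>{0..Tstar}.
       v t = v 0
         + frac_op_I T M r \<nu> v 0 / (r 0 0 * Gamma (1 + \<nu> 0)) * t powr \<nu> 0
         + 1 / Gamma (\<nu> 0) * integral {0..t}
             (\<lambda>\<tau>. (t - \<tau>) powr (\<nu> 0 - 1) * (caputo T (\<nu> 0) v \<tau> - caputo T (\<nu> 0) v 0)))"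
  proof -
  let ?g = "caputo T (\<nu> 0) v" and ?n = "\<nu> 0"
  \<comment> \<open>Downward induction from \<open>M\<close>; the case \<open>i = 0\<close> yields
    \<open>0 < \<nu> 0\<close>.\<close>
  have order: "\<nu> M \<le> \<nu> i" if "i \<le> M" for i
    using that by (induction rule: inc_induct) (use assms(4) in force)+
  have order0: "\<nu> i < \<nu> 0" if "0 < i" "i \<le> M" for i
    using that
  proof (induction i)
    case (Suc i)
    then show ?case using assms(4)[of i] by (cases "i = 0") auto
  qed simp
  have n: "0 < ?n" "?n < 1" using assms(3,5) order[of 0] by auto
  have g: "continuous_on {0..T} ?g" and D: "caputo_continuous T ?n v"
    using assms(7)[of 0] by (auto simp: caputo_continuous_def)
  note inv = caputo_inversion[OF n assms(6) D assms(1)]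
  have \<Gamma>: "Gamma ?n \<noteq> 0" using Gamma_real_pos[OF n(1)] by linarith
  have \<Gamma>1: "Gamma (1 + ?n) = ?n * Gamma ?n"
  proof -
    have "?n \<notin> \<int>\<^sub>\<le>\<^sub>0" using n by (auto elim!: nonpos_Ints_cases)
    then show ?thesis using Gamma_plus1[of ?n] by (simp add: add.commute)
  qed
  \<comment> \<open>Boundedness of the leading derivative turns, through the inversion formula, into
    \<open>v t - v 0 = O(t powr \<nu> 0)\<close>. Since the other orders lie strictly below
    \<open>\<nu> 0\<close>, their derivatives then vanish at 0.\<close>
  have "\<exists>B. \<forall>t\<in>{0..T}. \<bar>?g t\<bar> \<le> B"
    using compact_imp_bounded[OF compact_continuous_image[OF g compact_Icc]]
    by (simp add: bounded_iff)
  then obtain B where B: "\<And>t. t \<in> {0..T} \<Longrightarrow> \<bar>?g t\<bar> \<le> B"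
    by blast
  have bound: "\<bar>v t - v 0\<bar> \<le> B / ?n / Gamma ?n * t powr ?n" if t: "t \<in> {0..T}" for t
  proof -
    have "\<bar>abel ?n ?g t\<bar> \<le> B * (t powr ?n / ?n)"
      using t n B by (intro abel_bound continuous_on_subset[OF g]) auto
    then show ?thesis using \<Gamma> n by (simp add: inv[OF t] field_simps)
  qed
  have "caputo T (\<nu> i) v 0 = 0" if "0 < i" "i \<le> M" for i
    using caputo_0_eq_0[OF _ order0[OF that] n(1) assms(1,6) assms(7)[OF that(2)] bound] order0[OF that] n
    by auto
  then have "frac_op_I T M r \<nu> v 0 = r 0 0 * ?g 0"
    unfolding frac_op_I_def by (subst sum.atLeast_Suc_atMost) auto
  moreover have "r 0 0 \<noteq> 0" using assms(1,15) by simp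
  \<comment> \<open>Only the term with index 0 is left in the operator at 0. Its nonvanishing gives
    \<open>g0\<close>, and \<open>Gamma (1 + x) = x * Gamma x\<close> brings the constant of the
    theorem into the form \<open>C0\<close>.\<close>
  ultimately have g0: "?g 0 \<noteq> 0" and
    C0: "frac_op_I T M r \<nu> v 0 / (r 0 0 * Gamma (1 + ?n)) = ?g 0 / (?n * Gamma ?n)"
    using assms(16) by (auto simp: \<Gamma>1)
  have "((\<lambda>t. abel ?n ?g t / t powr ?n / Gamma ?n) \<longlongrightarrow> ?g 0 / ?n / Gamma ?n) (at_right 0)"
    by (rule tendsto_divide[OF tendsto_abel_powr_at_right[OF n(1) assms(1) g] tendsto_const \<Gamma>])
  then have "((\<lambda>t. (v t - v 0) / t powr ?n) \<longlongrightarrow> ?g 0 / ?n / Gamma ?n) (at_right 0)"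
    by (rule Lim_transform_eventually)
       (use assms(1) inv in \<open>auto simp: eventually_at_right_field intro!: exI[of _ T]\<close>)
  note ratio = tendsto_integral_ratio_powr[OF n(1) assms(1) _ this]
  have "((\<lambda>t. t * (v t - v 0) / integral {0..t} (\<lambda>\<tau>. v \<tau> - v 0)) \<longlongrightarrow> ?n + 1) (at_right 0)"
  proof (rule ratio)
    show "continuous_on {0..T} (\<lambda>\<tau>. v \<tau> - v 0)" by (intro continuous_intros assms(6))
    show "?g 0 / ?n / Gamma ?n \<noteq> 0" using g0 \<Gamma> n by simp
  qed
  from tendsto_diff[OF this tendsto_const[of 1]]
  have "((\<lambda>t. t * (v t - v 0) / integral {0..t} (\<lambda>\<tau>. v \<tau> - v 0) - 1) \<longlongrightarrow> ?n) (at_right 0)"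
    by simp
  \<comment> \<open>Splitting the constant \<open>caputo T (\<nu> 0) v 0\<close> off the density in
    the inversion formula produces the power term, since the kernel integrates to
    \<open>t powr \<nu> 0 / \<nu> 0\<close>.\<close>
  moreover have "v t = v 0 + ?g 0 / (?n * Gamma ?n) * t powr ?n + 1 / Gamma ?n * integral {0..t}
             (\<lambda>\<tau>. (t - \<tau>) powr (?n - 1) * (?g \<tau> - ?g 0))" if "t \<in> {0..Tstar}" for t
  proof -
    have t: "t \<in> {0..T}" using that assms(9) by auto
    then have "abel ?n (\<lambda>\<tau>. ?g \<tau> - ?g 0) t = abel ?n ?g t - ?g 0 * (t powr ?n / ?n)"
      using n by (subst abel_diff) (auto intro: continuous_on_subset[OF g] simp: abel_const)
    moreover have "v t = v 0 + abel ?n ?g t / Gamma ?n"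
      using inv[OF t] by simp
    ultimately show ?thesis
      using \<Gamma> n by (simp add: diff_divide_distrib flip: abel_def)
  qed
  ultimately show ?thesis unfolding C0 by blast
qed

end
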